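(* The boundary of the worm domain $\mathcal{W}$ is locally spherical away from the exceptional locus $\mathcal{A}$ and the caps $\mathcal{C}_{+},\mathcal{C}_{-}$; that is, $\partial\mathcal{W}\setminus(\mathcal{C}_{+}\cup\mathcal{C}_{-}\cup\mathcal{A})$ is locally spherical.
   Context: Fix $\mu>0$ and a smooth function $\eta:\mathbb{R}\to\mathbb{R}$ such that: (i) $\eta\ge 0$, $\eta$ is even and convex; (ii) $\eta^{-1}(0)=[-\mu,\mu]$; (iii) there exists $a>0$ such that $\eta(x)>1$ if $|x|>a$; (iv) $\eta'(x)\neq 0$ whenever $\eta(x)=1$. The Diederich--Fornæss worm domain is $$\mathcal{W}=\left\{(z,w)\in\mathbb{C}^2:\ z\neq 0,\ \left|w-e^{i\log|z|^2}\right|^2<1-\eta\left(\log|z|^2\right)\right\}.$$ The exceptional locus is the annulus $\mathcal{A}=\{(z,0)\in\partial\mathcal{W}:\ |\log|z|^2|\le\mu\}$. The caps are $\mathcal{C}_{+}=\{(z,w)\in\partial\mathcal{W}:\ \log|z|^2>\mu\}$ and $\mathcal{C}_{-}=\{(z,w)\in\partial\mathcal{W}:\ \log|z|^2<-\mu\}$. Thus $\partial\mathcal{W}\setminus(\mathcal{C}_{+}\cup\mathcal{C}_{-}\cup\mathcal{A})$ consists of the points $(z,w)\in\partial\mathcal{W}$ with $-\mu\le\log|z|^2\le\mu$ and $w\neq 0$. A real hypersurface $M\subset\mathbb{C}^2$ is locally spherical at $p\in M$ if there are an open neighborhood $U$ of $p$ in $\mathbb{C}^2$ and a biholomorphic map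 $\Phi$ from $U$ onto an open subset of $\mathbb{C}^2$ with $\Phi(M\cap U)\subset\mathbb{H}$, where $\mathbb{H}=\{(Z,W)\in\mathbb{C}^2:\operatorname{Im}W=|Z|^2\}$ is the Heisenberg hypersurface (locally biholomorphic to the unit sphere). A subset of $\partial\mathcal{W}$ is called locally spherical if $\partial\mathcal{W}$ is locally spherical at each of its points.
   Formalization: At edge points |log|z|²| = μ, w ≠ 0, the boundary is never locally spherical; the formal claim gives sphericity of ∂W where |log|z|²| < μ, and at all points, edges included, of the set ∂W∖(C₊∪C₋∪A) itself in place of ∂W. *)

theory Defs
  imports "HOL-Complex_Analysis.Complex_Analysis"
begin

definition smooth_real :: "(real \<Rightarrow> real) \<Rightarrow> bool" where
  "smooth_real f \<longleftrightarrow> (\<forall>n x. (deriv ^^ n) f differentiable (at x))"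

(* Holomorphy in two variables on an open set: the real Frechet derivative exists
   at every point and is complex linear. *)
definition holomorphic2_on :: "(complex \<times> complex \<Rightarrow> complex \<times> complex) \<Rightarrow> (complex \<times> complex) set \<Rightarrow> bool" where
  "holomorphic2_on f U \<longleftrightarrow>
     (\<forall>p\<in>U. \<exists>D. (f has_derivative D) (at p) \<and>
        (\<forall>c h k. D (c * h, c * k) = (c * fst (D (h, k)), c * snd (D (h, k)))))"

definition biholomorphic2 ::
  "(complex \<times> complex \<Rightarrow> complex \<times> complex) \<Rightarrow> (complex \<times> complex) set \<Rightarrow> (complex \<times> complex) set \<Rightarrow> bool" where
  "biholomorphic2 f U V \<longleftrightarrow>
     open U \<and> open V \<and> bij_betw f U V \<and>
     holomorphic2_on f U \<and> holomorphic2_on (inv_into U f) V"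

definition heisenberg_hypersurface :: "(complex \<times> complex) set" where
  "heisenberg_hypersurface = {(Z, W). Im W = (cmod Z)\<^sup>2}"

definition locally_spherical_at :: "(complex \<times> complex) set \<Rightarrow> complex \<times> complex \<Rightarrow> bool" where
  "locally_spherical_at M p \<longleftrightarrow>
     (\<exists>U V \<Phi>. p \<in> U \<and> biholomorphic2 \<Phi> U V \<and> \<Phi> ` (M \<inter> U) \<subseteq> heisenberg_hypersurface)"

(* The subset S of the hypersurface M is locally spherical. *)
definition locally_spherical_on :: "(complex \<times> complex) set \<Rightarrow> (complex \<times> complex) set \<Rightarrow> bool" where
  "locally_spherical_on M S \<longleftrightarrow> S \<subseteq> M \<and> (\<forall>p\<in>S. locally_spherical_at M p)"

definition worm :: "(real \<Rightarrow> real) \<Rightarrow> (complex \<times> complex) set" where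
  "worm \<eta> = {(z, w). z \<noteq> 0 \<and>
     (cmod (w - exp (\<i> * complex_of_real (ln ((cmod z)\<^sup>2)))))\<^sup>2 < 1 - \<eta> (ln ((cmod z)\<^sup>2))}"

(* In the sets below the library's value ln 0 = 0 plays no role for the profiles
   of interest: there the closure of the worm domain stays away from z = 0. *)
definition worm_annulus :: "real \<Rightarrow> (real \<Rightarrow> real) \<Rightarrow> (complex \<times> complex) set" where
  "worm_annulus \<mu> \<eta> = {(z, w). (z, w) \<in> frontier (worm \<eta>) \<and> w = 0 \<and> \<bar>ln ((cmod z)\<^sup>2)\<bar> \<le> \<mu>}"

definition worm_cap_plus :: "real \<Rightarrow> (real \<Rightarrow> real) \<Rightarrow> (complex \<times> complex) set" where
  "worm_cap_plus \<mu> \<eta> = {(z, w). (z, w) \<in> frontier (worm \<eta>) \<and> ln ((cmod z)\<^sup>2) > \<mu>}"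

definition worm_cap_minus :: "real \<Rightarrow> (real \<Rightarrow> real) \<Rightarrow> (complex \<times> complex) set" where
  "worm_cap_minus \<mu> \<eta> = {(z, w). (z, w) \<in> frontier (worm \<eta>) \<and> ln ((cmod z)\<^sup>2) < - \<mu>}"

definition worm_core :: "real \<Rightarrow> (real \<Rightarrow> real) \<Rightarrow> (complex \<times> complex) set" where
  "worm_core \<mu> \<eta> =
     frontier (worm \<eta>) - (worm_cap_plus \<mu> \<eta> \<union> worm_cap_minus \<mu> \<eta> \<union> worm_annulus \<mu> \<eta>)"

(* worm_core contains the edges, the points with \<bar>ln |z|^2\<bar> = \<mu> and w \<noteq> 0, which are limits
   of the caps.  The full boundary is not real analytic there, hence not locally
   spherical: it agrees with the level set of \<eta> = 0 on one side only. *)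
definition worm_core_interior :: "real \<Rightarrow> (real \<Rightarrow> real) \<Rightarrow> (complex \<times> complex) set" where
  "worm_core_interior \<mu> \<eta> = {(z, w). (z, w) \<in> worm_core \<mu> \<eta> \<and> \<bar>ln ((cmod z)\<^sup>2)\<bar> < \<mu>}"

end

theory Submission
  imports Defs
begin

text \<open>
  On \<open>z \<noteq> 0\<close>, where \<open>\<eta>\<close> vanishes, the boundary of the worm has the equation
  \<open>\<bar>w - e\<^sup>i\<^sup>t\<bar>\<^sup>2 = 1\<close> with \<open>t = log \<bar>z\<bar>\<^sup>2\<close>, that is \<open>\<bar>w\<bar>\<^sup>2 = 2 Re (e\<^sup>i\<^sup>t cnj w)\<close>.
  Near a point with \<open>z \<noteq> 0\<close> take a branch \<open>L\<close> of the logarithm and put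
  \<open>Z = exp (\<i> L(z))\<close>, the branch of \<open>z\<^sup>\<i>\<close>.  Since \<open>t = L(z) + cnj (L(z))\<close>, the
  unimodular factor is \<open>e\<^sup>i\<^sup>t = Z / cnj Z\<close>: up to \<open>cnj Z\<close> it is holomorphic in \<open>z\<close>.
  Multiplying the equation by \<open>\<bar>Z\<bar>\<^sup>2 / \<bar>w\<bar>\<^sup>2\<close> turns it into
  \<open>\<bar>Z\<bar>\<^sup>2 = 2 Re (Z\<^sup>2 / w)\<close>, which is the equation of the Heisenberg hypersurface for
  the pair \<open>(Z, W)\<close> with \<open>W = 2 \<i> Z\<^sup>2 / w\<close> (\<open>heisenberg_chart\<close>).

  The map \<open>(z, w) \<mapsto> (Z, W)\<close> is locally biholomorphic on \<open>z \<noteq> 0\<close>, \<open>w \<noteq> 0\<close>: the first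
  component is a locally invertible function of \<open>z\<close>, and \<open>w = 2 \<i> Z\<^sup>2 / W\<close> recovers
  \<open>w\<close>, so that the inverse has the same form (\<open>biholomorphic2_fibered\<close>).

  It remains to see that the boundary of the worm satisfies this equation where
  \<open>\<bar>log \<bar>z\<bar>\<^sup>2\<bar> \<le> \<mu>\<close>.  By continuity of \<open>\<eta>\<close> this holds away from \<open>z = 0\<close>, and a
  neighbourhood of \<open>z = 0\<close> does not meet the worm, because \<open>\<eta> > 1\<close> far out.
  Removing the annulus leaves exactly the points with \<open>w \<noteq> 0\<close>, where the chart exists.
  Every point of the core satisfies the equation, so the chart serves for the core at
  all of its points, edges included; for the full boundary it serves at the points that
  have a neighbourhood free of cap points, those with \<open>\<bar>log \<bar>z\<bar>\<^sup>2\<bar> < \<mu>\<close>.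
\<close>

section \<open>Fibered biholomorphic maps of two variables\<close>

lemma holomorphic2_on_fibered:
  assumes "open N" and a: "a holomorphic_on N" and b: "b holomorphic_on N"
  shows "holomorphic2_on (\<lambda>(z, w). (a z, b z / w)) (N \<times> - {0})"
  unfolding holomorphic2_on_def
proof
  fix p :: "complex \<times> complex"
  assume "p \<in> N \<times> - {0}"
  then obtain z w where p: "p = (z, w)" and z: "z \<in> N" and w: "w \<noteq> 0"
    by auto
  let ?a = "deriv a z" and ?b = "deriv b z"
  let ?D = "\<lambda>p. (?a * fst p, ?b * fst p / w - b z * snd p / w\<^sup>2)"
  have "(a has_derivative (\<lambda>h. ?a * h)) (at z)" "(b has_derivative (\<lambda>h. ?b * h)) (at z)"
    using holomorphic_derivI[OF a \<open>open N\<close> z] holomorphic_derivI[OF b \<open>open N\<close> z]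
    by (simp_all add: has_field_derivative_def)
  then have A: "((\<lambda>p. a (fst p)) has_derivative (\<lambda>p. ?a * fst p)) (at (z, w))"
    and B: "((\<lambda>p. b (fst p)) has_derivative (\<lambda>p. ?b * fst p)) (at (z, w))"
    by (auto intro: has_derivative_compose[OF has_derivative_fst[OF has_derivative_ident]])
  have "((\<lambda>p. (a (fst p), b (fst p) / snd p)) has_derivative ?D) (at (z, w))"
    by (rule derivative_eq_intros A B refl | use w in
        \<open>simp add: fun_eq_iff field_simps power2_eq_square\<close>)+
  then show "\<exists>D. ((\<lambda>(z, w). (a z, b z / w)) has_derivative D) (at p) \<and>
      (\<forall>c h k. D (c * h, c * k) = (c * fst (D (h, k)), c * snd (D (h, k))))"
    unfolding p by (intro exI[of _ ?D]) (simp add: case_prod_unfold algebra_simps)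
qed

lemma holomorphic2_on_cong:
  assumes "open V" and "\<And>p. p \<in> V \<Longrightarrow> f p = g p" and "holomorphic2_on g V"
  shows "holomorphic2_on f V"
  using assms unfolding holomorphic2_on_def
  by (metis has_derivative_transform_within_open)

text \<open>
  The map sends the fibre over \<open>z\<close> to the fibre over \<open>g z\<close> by the involution
  \<open>w \<mapsto> c z / w\<close> of the punctured plane; the inverse undoes \<open>g\<close> on the base and
  applies the same involution again.
\<close>
lemma biholomorphic2_fibered:
  assumes "open N" and g: "g holomorphic_on N" and inj: "inj_on g N"
    and c: "c holomorphic_on N" and c0: "\<And>z. z \<in> N \<Longrightarrow> c z \<noteq> 0"
  shows "biholomorphic2 (\<lambda>(z, w). (g z, c z / w)) (N \<times> - {0}) (g ` N \<times> - {0})"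
proof -
  let ?\<Phi> = "\<lambda>(z, w). (g z, c z / w)" and ?U = "N \<times> - {0::complex}" and ?V = "g ` N \<times> - {0::complex}"
  obtain h where h: "h holomorphic_on g ` N" and hg: "\<And>z. z \<in> N \<Longrightarrow> h (g z) = z"
    using holomorphic_has_inverse[OF g \<open>open N\<close> inj] by metis
  let ?\<Psi> = "\<lambda>(Z, W). (h Z, c (h Z) / W)"
  have opV: "open (g ` N)"
    using g \<open>open N\<close> inj by (rule open_mapping_thm3)
  have bij: "bij_betw ?\<Phi> ?U ?V"
    by (rule bij_betw_byWitness[where f' = ?\<Psi>]) (auto simp: hg c0)
  have "inv_into ?U ?\<Phi> q = ?\<Psi> q" if "q \<in> ?V" for q
    using bij that by (intro inv_into_f_eq) (auto simp: bij_betw_def hg c0)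
  moreover have "h ` g ` N \<subseteq> N"
    by (auto simp: hg)
  then have "(\<lambda>Z. c (h Z)) holomorphic_on g ` N"
    using holomorphic_on_compose_gen[OF h c] by (simp add: o_def image_subset_iff_funcset)
  then have "holomorphic2_on ?\<Psi> ?V"
    by (intro holomorphic2_on_fibered opV h)
  moreover have "open ?U" "open ?V"
    using \<open>open N\<close> opV by (auto intro!: open_Times)
  ultimately show ?thesis
    unfolding biholomorphic2_def
    using bij holomorphic2_on_fibered[OF \<open>open N\<close> g c] holomorphic2_on_cong by blast
qed

section \<open>The Heisenberg chart\<close>

text \<open>
  Differentiating \<open>exp (L z) = z\<close> shows that \<open>L\<close> has nonzero derivative, hence so has
  \<open>exp (\<i> L z)\<close>, the branch of \<open>z\<^sup>\<i>\<close> that is the first coordinate of the chart.  It is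
  not injective on large sets: \<open>z\<close> and \<open>exp (2 * pi) * z\<close> have the same image.
\<close>
lemma exp_ii_log_locally_injective:
  assumes "open G" "z0 \<in> G" "z0 \<noteq> 0"
  obtains N L where "open N" "z0 \<in> N" "N \<subseteq> G" "L holomorphic_on N"
    "\<And>z. z \<in> N \<Longrightarrow> exp (L z) = z" "inj_on (\<lambda>z. exp (\<i> * L z)) N"
proof -
  have "open (G - {0})"
    using \<open>open G\<close> by auto
  then obtain r where r: "r > 0" "ball z0 r \<subseteq> G - {0}"
    using assms by (metis DiffI open_contains_ball singletonD)
  obtain L where L: "L holomorphic_on ball z0 r" and eL: "\<And>z. z \<in> ball z0 r \<Longrightarrow> exp (L z) = z"
    using holomorphic_logarithm_exists[OF convex_ball open_ball holomorphic_on_ident, of z0 r z0] r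
    by (metis DiffE centre_in_ball insertI1 subsetD)
  have z0: "z0 \<in> ball z0 r"
    using r by simp
  have dL: "(L has_field_derivative deriv L z0) (at z0)"
    using holomorphic_derivI[OF L open_ball z0] .
  have "((\<lambda>z. exp (L z)) has_field_derivative exp (L z0) * deriv L z0) (at z0)"
    by (rule derivative_eq_intros dL refl)+
  moreover have "((\<lambda>z. exp (L z)) has_field_derivative 1) (at z0)"
    by (rule has_field_derivative_transform_within_open[OF DERIV_ident open_ball z0]) (simp add: eL)
  ultimately have "deriv L z0 \<noteq> 0"
    using DERIV_unique by fastforce
  moreover have "((\<lambda>z. exp (\<i> * L z)) has_field_derivative exp (\<i> * L z0) * (\<i> * deriv L z0)) (at z0)"
    by (rule derivative_eq_intros dL refl)+ simp
  ultimately have "deriv (\<lambda>z. exp (\<i> * L z)) z0 \<noteq> 0"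
    by (simp add: DERIV_imp_deriv)
  moreover have "(\<lambda>z. exp (\<i> * L z)) holomorphic_on ball z0 r"
    by (intro holomorphic_intros L)
  ultimately obtain s where s: "s > 0" "ball z0 s \<subseteq> ball z0 r" "inj_on (\<lambda>z. exp (\<i> * L z)) (ball z0 s)"
    using has_complex_derivative_locally_injective z0 open_ball by blast
  have "ball z0 s \<subseteq> G" and "L holomorphic_on ball z0 s"
    using s r L by (blast, metis holomorphic_on_subset)
  then show ?thesis
    using s eL by (intro that[of "ball z0 s" L]) auto
qed

text \<open>
  Here \<open>l\<close> may be any logarithm of \<open>z\<close>: another choice multiplies \<open>exp (\<i> l)\<close> by a
  positive number \<open>r\<close>, and \<open>(Z, W) \<mapsto> (r Z, r\<^sup>2 W)\<close> preserves the hypersurface.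
\<close>
lemma heisenberg_chart:
  assumes eq: "(cmod (w - exp (\<i> * complex_of_real (ln ((cmod z)\<^sup>2)))))\<^sup>2 = 1"
    and l: "exp l = z" and w: "w \<noteq> 0"
  shows "(exp (\<i> * l), 2 * \<i> * (exp (\<i> * l))\<^sup>2 / w) \<in> heisenberg_hypersurface"
proof -
  let ?Z = "exp (\<i> * l)" and ?e = "exp (\<i> * complex_of_real (ln ((cmod z)\<^sup>2)))"
  \<comment> \<open>This splitting of \<open>log \<bar>z\<bar>\<^sup>2\<close> makes the centre of the disc equal to \<open>Z / cnj Z\<close>.\<close>
  have "complex_of_real (ln ((cmod z)\<^sup>2)) = l + cnj l"
    using l by (auto simp: ln_realpow complex_add_cnj)
  then have e: "?e * cnj ?Z = ?Z"
    by (simp add: exp_cnj algebra_simps flip: exp_add)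
  have "(cmod (w - ?e))\<^sup>2 = (cmod w)\<^sup>2 + (cmod ?e)\<^sup>2 - 2 * Re (?e * cnj w)"
    unfolding cmod_power2 by (simp add: power2_eq_square algebra_simps)
  then have "(cmod w)\<^sup>2 = 2 * Re (?e * cnj w)"
    unfolding eq by simp
  then have "(cmod w)\<^sup>2 * (cmod ?Z)\<^sup>2 = 2 * Re (?e * cnj w) * (cmod ?Z)\<^sup>2"
    by simp
  also have "\<dots> = 2 * Re (?e * cnj w * complex_of_real ((cmod ?Z)\<^sup>2))"
    by simp
  also have "?e * cnj w * complex_of_real ((cmod ?Z)\<^sup>2) = ?e * cnj ?Z * ?Z * cnj w"
    by (simp only: complex_norm_square) (simp only: ac_simps)
  also have "\<dots> = ?Z\<^sup>2 / w * (w * cnj w)"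
    unfolding e using w by (simp add: power2_eq_square)
  also have "\<dots> = ?Z\<^sup>2 / w * complex_of_real ((cmod w)\<^sup>2)"
    by (simp only: complex_norm_square)
  also have "2 * Re \<dots> = (cmod w)\<^sup>2 * (2 * Re (?Z\<^sup>2 / w))"
    by (simp only: Re_complex_of_real times_complex.sel Im_complex_of_real) simp
  finally have "(cmod ?Z)\<^sup>2 = 2 * Re (?Z\<^sup>2 / w)"
    using w by (simp only: mult_cancel_left) simp
  moreover have "Im (2 * \<i> * ?Z\<^sup>2 / w) = 2 * Re (?Z\<^sup>2 / w)"
  proof -
    have "Im (2 * \<i> * q) = 2 * Re q" for q
      by simp
    from this[of "?Z\<^sup>2 / w"] show ?thesis
      by (simp only: times_divide_eq_right)
  qed
  ultimately show ?thesis
    by (simp add: heisenberg_hypersurface_def)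
qed

text \<open>
  The set \<open>M\<close> has to satisfy the equation only over \<open>G\<close>, which lets the same chart
  serve for the core and for the full boundary near a point off the caps.
\<close>
lemma locally_spherical_at_unit_circles:
  assumes "open G" "z0 \<in> G" "z0 \<noteq> 0" "w0 \<noteq> 0"
    and M: "\<And>z w. (z, w) \<in> M \<Longrightarrow> z \<in> G \<Longrightarrow>
      (cmod (w - exp (\<i> * complex_of_real (ln ((cmod z)\<^sup>2)))))\<^sup>2 = 1"
  shows "locally_spherical_at M (z0, w0)"
proof -
  obtain N L where N: "open N" "z0 \<in> N" "N \<subseteq> G" and L: "L holomorphic_on N"
    and eL: "\<And>z. z \<in> N \<Longrightarrow> exp (L z) = z" and inj: "inj_on (\<lambda>z. exp (\<i> * L z)) N"
    using exp_ii_log_locally_injective[OF assms(1-3)] by metis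
  let ?\<Phi> = "\<lambda>(z, w). (exp (\<i> * L z), 2 * \<i> * (exp (\<i> * L z))\<^sup>2 / w)"
  have "biholomorphic2 ?\<Phi> (N \<times> - {0}) ((\<lambda>z. exp (\<i> * L z)) ` N \<times> - {0})"
    by (intro biholomorphic2_fibered holomorphic_intros L N inj) simp
  moreover have "?\<Phi> ` (M \<inter> (N \<times> - {0})) \<subseteq> heisenberg_hypersurface"
  proof (rule image_subsetI)
    fix p
    assume "p \<in> M \<inter> (N \<times> - {0})"
    then obtain z w where p: "p = (z, w)" and zw: "(z, w) \<in> M" "z \<in> N" "w \<noteq> 0"
      by auto
    then have "z \<in> G"
      using N by blast
    then show "?\<Phi> p \<in> heisenberg_hypersurface"
      unfolding p prod.case using zw by (intro heisenberg_chart M) (auto simp: eL)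
  qed
  ultimately show ?thesis
    unfolding locally_spherical_at_def using N \<open>w0 \<noteq> 0\<close>
    by (intro exI[of _ "N \<times> - {0}"] exI conjI) auto
qed

section \<open>The boundary of the worm\<close>

lemma continuous_on_worm_function:
  fixes \<eta> :: "real \<Rightarrow> real"
  assumes "continuous_on UNIV \<eta>"
  shows "continuous_on ((- {0}) \<times> UNIV) (\<lambda>p. (cmod (snd p - exp (\<i> * complex_of_real (ln ((cmod (fst p))\<^sup>2)))))\<^sup>2
           + \<eta> (ln ((cmod (fst p))\<^sup>2)))"
  by (intro continuous_intros continuous_on_compose2[OF assms]) auto

text \<open>
  Both strict inequalities define open sets over \<open>z \<noteq> 0\<close>: the points with \<open><\<close> are
  interior to the worm, those with \<open>>\<close> are exterior to it.
\<close>
lemma frontier_worm_equation: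
  assumes cont: "continuous_on UNIV \<eta>" and zw: "(z, w) \<in> frontier (worm \<eta>)" and z: "z \<noteq> 0"
  shows "(cmod (w - exp (\<i> * complex_of_real (ln ((cmod z)\<^sup>2)))))\<^sup>2 = 1 - \<eta> (ln ((cmod z)\<^sup>2))"
proof -
  define F where "F = (\<lambda>p. (cmod (snd p - exp (\<i> * complex_of_real (ln ((cmod (fst p))\<^sup>2)))))\<^sup>2
           + \<eta> (ln ((cmod (fst p))\<^sup>2)))"
  let ?O = "(- {0}) \<times> UNIV :: (complex \<times> complex) set"
  have F: "continuous_on ?O F"
    unfolding F_def by (rule continuous_on_worm_function[OF cont])
  have O: "open ?O"
    by (intro open_Times) auto
  have worm: "worm \<eta> = ?O \<inter> F -` {..<1}"
    by (auto simp: worm_def F_def)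
  have "open (worm \<eta>)"
    unfolding worm by (rule continuous_open_preimage[OF F O]) simp
  then have "(z, w) \<notin> worm \<eta>"
    using zw by (simp add: frontier_def interior_open)
  then have "\<not> F (z, w) < 1"
    using z by (simp add: worm)
  moreover have "\<not> F (z, w) > 1"
  proof
    assume "F (z, w) > 1"
    then have "(z, w) \<in> ?O \<inter> F -` {1<..}"
      using z by simp
    moreover have "open (?O \<inter> F -` {1<..})"
      by (rule continuous_open_preimage[OF F O]) simp
    moreover have "worm \<eta> \<inter> (?O \<inter> F -` {1<..}) = {}"
      by (auto simp: worm)
    ultimately show False
      using zw by (auto simp: frontier_def Int_commute dest: open_Int_closure_eq_empty)
  qed
  ultimately show ?thesis
    by (simp add: F_def)
qed

text \<open>
  Near \<open>z = 0\<close> the number \<open>log \<bar>z\<bar>\<^sup>2\<close> is below \<open>- a\<close>, hence \<open>\<eta> > 1\<close> there and the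
  disc that defines the fibre of the worm is empty.
\<close>
lemma frontier_worm_nonzero:
  assumes eta: "\<And>x. x < - a \<Longrightarrow> \<eta> x > 1" and zw: "(z, w) \<in> frontier (worm \<eta>)"
  shows "z \<noteq> 0"
proof
  assume "z = 0"
  let ?B = "ball 0 (exp (- a / 2)) \<times> UNIV :: (complex \<times> complex) set"
  have "worm \<eta> \<inter> ?B = {}"
  proof (intro equals0I)
    fix p assume p: "p \<in> worm \<eta> \<inter> ?B"
    obtain z w where "p = (z, w)" by force
    with p have z: "z \<noteq> 0" "cmod z < exp (- a / 2)"
      and w: "(cmod (w - exp (\<i> * complex_of_real (ln ((cmod z)\<^sup>2)))))\<^sup>2 < 1 - \<eta> (ln ((cmod z)\<^sup>2))"
      by (auto simp: worm_def)
    have "ln (cmod z) < ln (exp (- a / 2))"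
      using z by (subst ln_less_cancel_iff) auto
    then have "ln ((cmod z)\<^sup>2) < - a"
      using z by (simp add: ln_realpow)
    then show False
      using eta w by (smt (verit) zero_le_power2)
  qed
  moreover have "open ?B"
    by (intro open_Times) auto
  ultimately have "closure (worm \<eta>) \<inter> ?B = {}"
    by (metis Int_commute open_Int_closure_eq_empty)
  then show False
    using zw \<open>z = 0\<close> by (auto simp: frontier_def)
qed

theorem corollary1:
  fixes \<mu> :: real and \<eta> :: "real \<Rightarrow> real"
  assumes "\<mu> > 0"
    and "smooth_real \<eta>"
    and "\<And>x. \<eta> x \<ge> 0"
    and "\<And>x. \<eta> (- x) = \<eta> x"
    and "convex_on UNIV \<eta>"
    and "\<eta> -` {0} = {-\<mu>..\<mu>}"
    and "\<exists>a>0. \<forall>x. \<bar>x\<bar> > a \<longrightarrow> \<eta> x > 1"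
    and "\<And>x. \<eta> x = 1 \<Longrightarrow> deriv \<eta> x \<noteq> 0"
  shows "locally_spherical_on (frontier (worm \<eta>)) (worm_core_interior \<mu> \<eta>)
       \<and> locally_spherical_on (worm_core \<mu> \<eta>) (worm_core \<mu> \<eta>)"
proof -
  have "\<eta> differentiable (at x)" for x
    using \<open>smooth_real \<eta>\<close> unfolding smooth_real_def by (metis funpow_0)
  then have cont: "continuous_on UNIV \<eta>"
    by (simp add: continuous_at_imp_continuous_on differentiable_imp_continuous_within)
  obtain a where "\<And>x. x < - a \<Longrightarrow> \<eta> x > 1"
    using assms(7) by (metis abs_ge_minus_self less_minus_iff order_less_le_trans)
  then have nz: "z \<noteq> 0" if "(z, w) \<in> frontier (worm \<eta>)" for z w
    using that by (rule frontier_worm_nonzero)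
  have eq: "(cmod (w - exp (\<i> * complex_of_real (ln ((cmod z)\<^sup>2)))))\<^sup>2 = 1"
    if "(z, w) \<in> frontier (worm \<eta>)" and "\<bar>ln ((cmod z)\<^sup>2)\<bar> \<le> \<mu>" for z w
  proof -
    have "ln ((cmod z)\<^sup>2) \<in> \<eta> -` {0}"
      unfolding assms(6) atLeastAtMost_iff using that(2) by linarith
    then show ?thesis
      using frontier_worm_equation[OF cont that(1) nz[OF that(1)]] by simp
  qed
  have core: "(z, w) \<in> frontier (worm \<eta>) \<and> \<bar>ln ((cmod z)\<^sup>2)\<bar> \<le> \<mu> \<and> z \<noteq> 0 \<and> w \<noteq> 0"
    if "(z, w) \<in> worm_core \<mu> \<eta>" for z w
    using that nz[of z w]
    unfolding worm_core_def worm_cap_plus_def worm_cap_minus_def worm_annulus_def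
    by (auto simp: abs_le_iff not_less minus_le_iff)
  have "locally_spherical_at (worm_core \<mu> \<eta>) (z, w)" if "(z, w) \<in> worm_core \<mu> \<eta>" for z w
    by (rule locally_spherical_at_unit_circles[of UNIV]) (use core that eq in auto)
  moreover have "locally_spherical_at (frontier (worm \<eta>)) (z, w)"
    if "(z, w) \<in> worm_core_interior \<mu> \<eta>" for z w
  proof -
    have zw: "(z, w) \<in> worm_core \<mu> \<eta>" and l: "\<bar>ln ((cmod z)\<^sup>2)\<bar> < \<mu>"
      using that by (auto simp: worm_core_interior_def)
    \<comment> \<open>The full boundary contains the caps, where the fibres are smaller discs, so the
      neighbourhood has to keep \<open>\<bar>log \<bar>z\<bar>\<^sup>2\<bar>\<close> below \<open>\<mu>\<close>; this is possible because the
      point is not on an edge.\<close>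
    let ?G = "- {0} \<inter> (\<lambda>z. \<bar>ln ((cmod z)\<^sup>2)\<bar>) -` {..<\<mu>}"
    have "open ?G"
      by (intro continuous_open_preimage continuous_intros) auto
    then show ?thesis
      by (rule locally_spherical_at_unit_circles) (use core[OF zw] l eq in auto)
  qed
  ultimately show ?thesis
    unfolding locally_spherical_on_def by (auto simp: worm_core_interior_def worm_core_def)
qed

end
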